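(* Let $\{a_k\}_{k\in\mathbb{N}^+}$ be a sequence of positive real numbers and $\alpha=\inf_{k\in\mathbb{N}^+}a_k$. Let $n\in\mathbb{N}^+$ and $$X=\{x=(x_1,\dots,x_n)\in\mathbb{R}^n:\ x_i>0 \text{ for } i=1,\dots,n \text{ and } x_1+\cdots+x_n=1\}.$$ Let $z>0$, $\beta\in\mathbb{R}$, and let $r\in\mathbb{R}$ be such that $\alpha>r$. Assume that each Hurwitz-Lerch zeta function (series) appearing below is convergent. Then: If $\beta r>0$, then $$\min_{x\in X}\sum_{i=1}^{n}x_i\,\zeta\left(z,\beta,a_n-rx_i\right)=\zeta\left(z,\beta,a_n-\frac rn\right).$$ If one of the following holds: (1) $\beta>0$, $r<0$ and $2(\alpha-r)\ge-(\beta+1)r$; (2) $\beta<-1$, $r>0$ and $2(\alpha-r)\ge-(\beta+1)r$; (3) $\beta\in[-1,0)$ and $r>0$; then $$\max_{x\in X}\sum_{i=1}^{n}x_i\,\zeta\left(z,\beta,a_n-rx_i\right)=\zeta\left(z,\beta,a_n-\frac rn\right).$$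
   Context: The Hurwitz-Lerch zeta function is defined by $$\zeta(z,\beta,a):=\sum_{j=0}^{\infty}\frac{z^j}{(j+a)^\beta}.$$ Only real variables are considered here. In the statement, $a_n$ is the $n$-th term of the sequence, with the same $n$ as the dimension of $x$. *)

theory Defs
  imports "HOL-Analysis.Analysis"
begin

(* Real variables only. All uses have a > 0, so every base real j + a is positive and powr is the
   usual real power; suminf is meaningful only under hurwitz_lerch_convergent. *)
definition hurwitz_lerch_term :: "real \<Rightarrow> real \<Rightarrow> real \<Rightarrow> nat \<Rightarrow> real" where
  "hurwitz_lerch_term z \<beta> a j = z ^ j / (real j + a) powr \<beta>"

definition hurwitz_lerch_zeta :: "real \<Rightarrow> real \<Rightarrow> real \<Rightarrow> real" where
  "hurwitz_lerch_zeta z \<beta> a = (\<Sum>j. hurwitz_lerch_term z \<beta> a j)"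

definition hurwitz_lerch_convergent :: "real \<Rightarrow> real \<Rightarrow> real \<Rightarrow> bool" where
  "hurwitz_lerch_convergent z \<beta> a \<longleftrightarrow> summable (hurwitz_lerch_term z \<beta> a)"

definition open_simplex :: "(real ^ 'n) set" where
  "open_simplex = {x. (\<forall>i. x $ i > 0) \<and> (\<Sum>i\<in>UNIV. x $ i) = 1}"

(* Attained extrema over possibly infinite sets, where Min and Max are not applicable. *)
definition has_min_on :: "('a \<Rightarrow> real) \<Rightarrow> 'a set \<Rightarrow> real \<Rightarrow> bool" where
  "has_min_on f S m \<longleftrightarrow> (\<exists>x\<in>S. f x = m) \<and> (\<forall>x\<in>S. m \<le> f x)"

definition has_max_on :: "('a \<Rightarrow> real) \<Rightarrow> 'a set \<Rightarrow> real \<Rightarrow> bool" where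
  "has_max_on f S m \<longleftrightarrow> (\<exists>x\<in>S. f x = m) \<and> (\<forall>x\<in>S. f x \<le> m)"

end

theory Submission
  imports Defs
begin

(* For each c = j + a_n the map g(t) = t (c - r t)^(-beta) has
   g''(t) = beta r (c - r t)^(-beta-2) (2 c + (beta - 1) r t). Each hypothesis makes the last factor
   nonnegative on [0,1], so the sign of beta r decides whether g is convex or concave there.
   Jensen's inequality with equal weights, applied to every term of the series, then compares x with
   the barycentre of the simplex. *)

lemma mem_open_simplex_atLeastAtMost:
  fixes x :: "real ^ 'n"
  assumes "x \<in> open_simplex"
  shows "x $ i \<in> {0..1}"
proof -
  have pos: "\<And>i. x $ i > 0" and sum1: "(\<Sum>i\<in>UNIV. x $ i) = 1"
    using assms by (auto simp: open_simplex_def)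
  have "x $ i \<le> (\<Sum>i\<in>UNIV. x $ i)"
    by (rule member_le_sum) (auto intro: less_imp_le pos)
  then show ?thesis
    using pos[of i] sum1 by simp
qed

lemma barycentre_mem_open_simplex:
  "(\<chi> i. 1 / real CARD('n)) \<in> (open_simplex :: (real ^ 'n) set)"
  by (simp add: open_simplex_def)

text \<open>With equal weights, the averaged argument in Jensen's inequality is the mean of the
  coordinates, which is the same for every point of the simplex because they sum to 1.\<close>

lemma convex_on_open_simplex_jensen:
  fixes x :: "real ^ 'n"
  assumes "convex_on {0..1} g" and "x \<in> open_simplex"
  shows "real CARD('n) * g (1 / real CARD('n)) \<le> (\<Sum>i\<in>UNIV. g (x $ i))"
proof -
  have sum1: "(\<Sum>i\<in>UNIV. x $ i) = 1"
    using assms(2) by (simp add: open_simplex_def)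
  have "g (\<Sum>i\<in>UNIV. (1 / real CARD('n)) *\<^sub>R (x $ i)) \<le> (\<Sum>i\<in>UNIV. (1 / real CARD('n)) * g (x $ i))"
    by (rule convex_on_sum) (use assms in \<open>auto dest: mem_open_simplex_atLeastAtMost\<close>)
  then have "g (1 / real CARD('n)) \<le> (\<Sum>i\<in>UNIV. g (x $ i)) / real CARD('n)"
    using sum1 by (simp flip: sum_divide_distrib)
  then show ?thesis
    by (simp add: field_simps)
qed

text \<open>The hypothesis \<open>sgn\<close> is the sign of the second derivative with the positive
  power of \<open>c - r * t\<close> divided out, so that only a polynomial inequality is left to the
  caller.\<close>

lemma convex_on_mult_powr:
  fixes s c r b :: real
  assumes pos: "\<And>t. t \<in> {0..1} \<Longrightarrow> c - r * t > 0"
    and sgn: "\<And>t. t \<in> {0..1} \<Longrightarrow> s * (b * r) * (2 * c + (b - 1) * r * t) \<ge> 0"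
  shows "convex_on {0..1} (\<lambda>t. s * (t * (c - r * t) powr (- b)))"
proof (rule f''_ge0_imp_convex)
  let ?f' = "\<lambda>t. s * ((c - r * t) powr (- b) + t * (b * r * (c - r * t) powr (- b - 1)))"
  let ?f'' = "\<lambda>t. s * (b * r) * (2 * c + (b - 1) * r * t) * (c - r * t) powr (- b - 2)"
  fix t :: real
  assume t: "t \<in> {0..1}"
  note u = pos[OF t]
  \<comment> \<open>Brings both terms of the second derivative to one common power; the remaining
    bracket is \<open>2 * (c - r * t) + (b + 1) * r * t\<close>, which equals
    \<open>2 * c + (b - 1) * r * t\<close>.\<close>
  have p1: "(c - r * t) powr (- b - 1) = (c - r * t) * (c - r * t) powr (- b - 2)"
    using u powr_mult_base[of "c - r * t" "- b - 2"] by (simp add: minus_diff_commute[of b 1])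
  \<comment> \<open>The exponent is left free: the first derivative needs \<open>p = - b\<close>,
    the second also \<open>p = - b - 1\<close>.\<close>
  have D: "((\<lambda>t. (c - r * t) powr p) has_real_derivative (- p * r) * (c - r * t) powr (p - 1)) (at t)" for p
    by (rule DERIV_cong[OF DERIV_fun_powr[where m = "- r"]]) (use u in \<open>auto intro!: derivative_eq_intros\<close>)
  show "((\<lambda>t. s * (t * (c - r * t) powr (- b))) has_real_derivative ?f' t) (at t)"
    by (rule DERIV_cong, rule DERIV_cmult, rule DERIV_mult[OF DERIV_ident D]) (simp add: algebra_simps)
  have "- b - 1 - 1 = - b - 2"
    by simp
  then have "(?f' has_real_derivative
      s * (2 * (b * r * (c - r * t) powr (- b - 1))
        + t * (b * (b + 1) * r\<^sup>2 * (c - r * t) powr (- b - 2)))) (at t)"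
    by (intro DERIV_cong[OF DERIV_cmult[OF DERIV_add[OF D DERIV_mult[OF DERIV_ident DERIV_cmult[OF D]]]]])
      (simp add: algebra_simps power2_eq_square)
  also have "s * (2 * (b * r * (c - r * t) powr (- b - 1))
        + t * (b * (b + 1) * r\<^sup>2 * (c - r * t) powr (- b - 2))) = ?f'' t"
    unfolding p1 by (simp add: algebra_simps power2_eq_square)
  finally show "(?f' has_real_derivative ?f'' t) (at t)" .
  show "?f'' t \<ge> 0"
    using sgn[OF t] by simp
qed simp

(* The sign s = 1 or s = -1 selects the convex or the concave case. *)
lemma hurwitz_lerch_zeta_open_simplex_jensen:
  fixes x :: "real ^ 'n" and s a r z \<beta> :: real
  assumes z: "z > 0"
    and pos: "\<And>t. t \<in> {0..1} \<Longrightarrow> a - r * t > 0"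
    and sgn: "\<And>c t. c \<ge> a \<Longrightarrow> t \<in> {0..1} \<Longrightarrow> s * (\<beta> * r) * (2 * c + (\<beta> - 1) * r * t) \<ge> 0"
    and conv: "\<And>i. hurwitz_lerch_convergent z \<beta> (a - r * x $ i)"
    and conv': "hurwitz_lerch_convergent z \<beta> (a - r / real CARD('n))"
    and x: "x \<in> open_simplex"
  shows "s * hurwitz_lerch_zeta z \<beta> (a - r / real CARD('n))
    \<le> s * (\<Sum>i\<in>UNIV. x $ i * hurwitz_lerch_zeta z \<beta> (a - r * x $ i))"
proof -
  let ?T = "hurwitz_lerch_term z \<beta>"
  have T: "?T (a - r * t) j = z ^ j * ((real j + a) - r * t) powr (- \<beta>)" for t j
    by (simp add: hurwitz_lerch_term_def powr_minus_divide algebra_simps)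
  have termwise: "s * ?T (a - r / real CARD('n)) j \<le> s * (\<Sum>i\<in>UNIV. x $ i * ?T (a - r * x $ i) j)" for j
  proof -
    have "convex_on {0..1} (\<lambda>t. s * (t * ((real j + a) - r * t) powr (- \<beta>)))"
    proof (rule convex_on_mult_powr)
      show "real j + a - r * t > 0" if "t \<in> {0..1}" for t
        using pos[OF that] by linarith
      show "s * (\<beta> * r) * (2 * (real j + a) + (\<beta> - 1) * r * t) \<ge> 0" if "t \<in> {0..1}" for t
        by (rule sgn) (use that in auto)
    qed
    \<comment> \<open>The factor \<open>real CARD('n)\<close> cancels the leading
      \<open>t = 1 / real CARD('n)\<close> at the barycentre, leaving a single power there.\<close>
    from convex_on_open_simplex_jensen[OF this x]
    have "s * ((real j + a) - r * (1 / real CARD('n))) powr (- \<beta>)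
        \<le> (\<Sum>i\<in>UNIV. s * (x $ i * ((real j + a) - r * x $ i) powr (- \<beta>)))"
      by simp
    then have "z ^ j * (s * ((real j + a) - r * (1 / real CARD('n))) powr (- \<beta>))
        \<le> z ^ j * (\<Sum>i\<in>UNIV. s * (x $ i * ((real j + a) - r * x $ i) powr (- \<beta>)))"
      by (rule mult_left_mono) (use z in simp)
    then show ?thesis
      using T[of "1 / real CARD('n)" j] by (simp add: T sum_distrib_left mult_ac)
  qed
  \<comment> \<open>Convergence at each coordinate lets the finite sum over \<open>i\<close> be
    exchanged with the series, so the termwise bound can be summed over \<open>j\<close>.\<close>
  have "(\<lambda>j. s * (\<Sum>i\<in>UNIV. x $ i * ?T (a - r * x $ i) j))
      sums (s * (\<Sum>i\<in>UNIV. x $ i * hurwitz_lerch_zeta z \<beta> (a - r * x $ i)))"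
    unfolding hurwitz_lerch_zeta_def
    by (intro sums_mult sums_sum summable_sums conv[unfolded hurwitz_lerch_convergent_def])
  moreover have "(\<lambda>j. s * ?T (a - r / real CARD('n)) j)
      sums (s * hurwitz_lerch_zeta z \<beta> (a - r / real CARD('n)))"
    unfolding hurwitz_lerch_zeta_def
    by (intro sums_mult summable_sums conv'[unfolded hurwitz_lerch_convergent_def])
  ultimately show ?thesis
    by (rule sums_le[OF termwise, rotated])
qed

theorem theorem5p1:
  fixes a :: "nat \<Rightarrow> real" and \<alpha> z \<beta> r :: real
  assumes "\<And>k. k \<ge> 1 \<Longrightarrow> a k > 0"
    and "\<alpha> = (INF k\<in>{1..}. a k)"
    and "z > 0"
    and "\<alpha> > r"
    and "\<And>(x :: real ^ 'n) i. x \<in> open_simplex \<Longrightarrow>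
           hurwitz_lerch_convergent z \<beta> (a CARD('n) - r * x $ i)"
    and "hurwitz_lerch_convergent z \<beta> (a CARD('n) - r / real CARD('n))"
  shows "(\<beta> * r > 0 \<longrightarrow>
            has_min_on
              (\<lambda>x :: real ^ 'n. \<Sum>i\<in>UNIV. x $ i * hurwitz_lerch_zeta z \<beta> (a CARD('n) - r * x $ i))
              open_simplex
              (hurwitz_lerch_zeta z \<beta> (a CARD('n) - r / real CARD('n))))
       \<and> ((\<beta> > 0 \<and> r < 0 \<and> 2 * (\<alpha> - r) \<ge> - (\<beta> + 1) * r)
          \<or> (\<beta> < -1 \<and> r > 0 \<and> 2 * (\<alpha> - r) \<ge> - (\<beta> + 1) * r)
          \<or> (\<beta> \<in> {-1..<0} \<and> r > 0) \<longrightarrow>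
            has_max_on
              (\<lambda>x :: real ^ 'n. \<Sum>i\<in>UNIV. x $ i * hurwitz_lerch_zeta z \<beta> (a CARD('n) - r * x $ i))
              open_simplex
              (hurwitz_lerch_zeta z \<beta> (a CARD('n) - r / real CARD('n))))"
proof -
  let ?N = "CARD('n)"
  let ?F = "\<lambda>x :: real ^ 'n. \<Sum>i\<in>UNIV. x $ i * hurwitz_lerch_zeta z \<beta> (a ?N - r * x $ i)"
  let ?m = "hurwitz_lerch_zeta z \<beta> (a ?N - r / real ?N)"
  have N: "?N \<ge> 1"
    by (simp add: Suc_leI)
  \<comment> \<open>The infimum enters only through this bound; positivity of the sequence supplies
    the lower bound 0 that makes it a genuine infimum.\<close>
  have "\<alpha> \<le> a ?N"
    unfolding assms(2)
    by (rule cINF_lower) (use N assms(1) in \<open>auto intro!: bdd_belowI[of _ 0] less_imp_le\<close>)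
  have "a ?N > 0"
    using N assms(1) by blast
  have pos: "a ?N - r * t > 0" if "t \<in> {0..1}" for t
  proof (cases "r > 0")
    case True
    then have "r * t \<le> r * 1"
      using that by (intro mult_left_mono) auto
    then show ?thesis
      using \<open>\<alpha> \<le> a ?N\<close> assms(4) by linarith
  next
    case False
    then have "r * t \<le> 0"
      using that by (simp add: mult_nonpos_nonneg)
    then show ?thesis
      using \<open>a ?N > 0\<close> by linarith
  qed
  \<comment> \<open>At the barycentre the sum consists of equal terms whose weights add up to 1.
    This serves both extrema.\<close>
  have attained: "\<exists>x\<in>open_simplex. ?F x = ?m"
    by (rule bexI[OF _ barycentre_mem_open_simplex]) simp
  have jensen: "s * ?m \<le> s * ?F x"
    if "\<And>c t. c \<ge> a ?N \<Longrightarrow> t \<in> {0..1} \<Longrightarrow> s * (\<beta> * r) * (2 * c + (\<beta> - 1) * r * t) \<ge> 0"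
      "x \<in> open_simplex" for s and x :: "real ^ 'n"
    by (rule hurwitz_lerch_zeta_open_simplex_jensen)
      (use assms(3) pos that assms(5)[OF that(2)] assms(6) in auto)
  \<comment> \<open>The expression is affine in \<open>t\<close>, so its least value is at an
    endpoint: \<open>t = 0\<close> in the first alternative, where it is \<open>2 * c > 0\<close>,
    and otherwise \<open>t = 1\<close>.\<close>
  have factor: "2 * c + (\<beta> - 1) * r * t \<ge> 0"
    if "(\<beta> - 1) * r \<ge> 0 \<or> 2 * a ?N + (\<beta> - 1) * r \<ge> 0" "c \<ge> a ?N" "t \<in> {0..1}" for c t
  proof (cases "(\<beta> - 1) * r \<ge> 0")
    case True
    then have "(\<beta> - 1) * r * t \<ge> 0"
      using that(3) by (intro mult_nonneg_nonneg[of "(\<beta> - 1) * r"]) auto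
    then show ?thesis
      using that(2) \<open>a ?N > 0\<close> by linarith
  next
    case False
    then have "(\<beta> - 1) * r * t \<ge> (\<beta> - 1) * r * 1"
      using that(3) by (intro mult_left_mono_neg) auto
    then show ?thesis
      using that(1,2) False by linarith
  qed
  show ?thesis
  proof (intro conjI impI)
    assume br: "\<beta> * r > 0"
    \<comment> \<open>The second alternative holds: \<open>2 * a ?N - r\<close> is the sum of the
      positive numbers \<open>a ?N\<close> and \<open>a ?N - r\<close>, and
      \<open>\<beta> * r\<close> is positive.\<close>
    have "(\<beta> - 1) * r \<ge> 0 \<or> 2 * a ?N + (\<beta> - 1) * r \<ge> 0"
      using br \<open>\<alpha> \<le> a ?N\<close> \<open>a ?N > 0\<close> assms(4) by (simp add: algebra_simps)
    from factor[OF this] have "?m \<le> ?F x" if "x \<in> open_simplex" for x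
      using jensen[of 1 x] that br by simp
    then show "has_min_on ?F open_simplex ?m"
      using attained by (auto simp: has_min_on_def)
  next
    assume h: "(\<beta> > 0 \<and> r < 0 \<and> 2 * (\<alpha> - r) \<ge> - (\<beta> + 1) * r)
          \<or> (\<beta> < -1 \<and> r > 0 \<and> 2 * (\<alpha> - r) \<ge> - (\<beta> + 1) * r)
          \<or> (\<beta> \<in> {-1..<0} \<and> r > 0)"
    have br: "\<beta> * r < 0"
      using h by (auto simp: mult_less_0_iff)
    have "2 * a ?N + (\<beta> - 1) * r \<ge> 0"
    proof (cases "\<beta> \<in> {-1..<0} \<and> r > 0")
      case True
      \<comment> \<open>Hence the value at \<open>t = 1\<close> is at least
        \<open>2 * (a ?N - r)\<close>, which is positive since \<open>\<alpha> > r\<close>.\<close>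
      then have "-1 * r \<le> \<beta> * r"
        by (intro mult_right_mono) auto
      then show ?thesis
        using \<open>\<alpha> \<le> a ?N\<close> assms(4) by (simp add: algebra_simps)
    next
      case False
      \<comment> \<open>This rearranges to \<open>2 * \<alpha> + (\<beta> - 1) * r \<ge> 0\<close>,
        the endpoint condition with \<alpha> in place of \<open>a ?N\<close>.\<close>
      then have "2 * (\<alpha> - r) \<ge> - (\<beta> + 1) * r"
        using h by blast
      then show ?thesis
        using \<open>\<alpha> \<le> a ?N\<close> by (simp add: algebra_simps)
    qed
    then have *: "(\<beta> - 1) * r \<ge> 0 \<or> 2 * a ?N + (\<beta> - 1) * r \<ge> 0" ..
    have "?F x \<le> ?m" if "x \<in> open_simplex" for x
    proof -
      have "- 1 * ?m \<le> - 1 * ?F x"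
      proof (rule jensen[OF _ that])
        fix c t :: real
        assume "c \<ge> a ?N" "t \<in> {0..1}"
        from factor[OF * this] show "- 1 * (\<beta> * r) * (2 * c + (\<beta> - 1) * r * t) \<ge> 0"
          using br by (intro mult_nonneg_nonneg[of "- 1 * (\<beta> * r)"]) auto
      qed
      then show ?thesis
        by simp
    qed
    then show "has_max_on ?F open_simplex ?m"
      using attained by (auto simp: has_max_on_def)
  qed
qed

end
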